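(* Consider the discretised A-optimal objective $$\mathcal{J}(w):=\operatorname{tr}(\mathcal{C}_{\mathrm{post}}(w))=\operatorname{tr}\Big(\big(F^T\operatorname{Diag}(w)F+I\big)^{-1}M^{1/2}\mathcal{C}_0M^{-1/2}\Big),\qquad F:=\Gamma^{-1/2}\mathcal{F}\,\mathcal{C}_0^{1/2}M^{-1/2}\in\mathbb{R}^{m\times n},$$ with all objects as in the context. Let $\ell\in\mathbb{N}$ be such that there exists a thin QR decomposition $F^T=QR\in\mathbb{R}^{n\times m}$, where $Q\in\mathbb{R}^{n\times\ell}$ is semi-orthogonal, that is, $Q^TQ=I_\ell$, and $R\in\mathbb{R}^{\ell\times m}$ is upper triangular. Write $$L_w:=R\operatorname{Diag}(w)R^T+I_\ell\in\mathbb{R}^{\ell\times\ell},\qquad C:=Q^TM^{1/2}\mathcal{C}_0M^{-1/2}Q\in\mathbb{R}^{\ell\times\ell},$$ the latter being independent of $w$ and being decomposed as $C=(C^{1/2})^TC^{1/2}$. Then, given data $g\in\mathbb{R}^m$ and a prior mean $m_0\in\mathbb{R}^n_M$, the posterior distribution $\mathcal{N}(m_{\mathrm{post}}(w),\mathcal{C}_{\mathrm{post}}(w))$ satisfies $$m_{\mathrm{post}}(w)=\mathcal{C}_0^{1/2}M^{-1/2}QL_w^{-1}R\,\Gamma^{-1/2}g+\mathcal{C}_{\mathrm{post}}(w)\mathcal{C}_0^{-1}m_0,$$ $$\mathcal{C}_{\mathrm{post}}(w)=\mathcal{C}_0^{1/2}M^{-1/2}\big(I-QQ^T+QL_w^{-1}Q^T\big)M^{1/2}\mathcal{C}_0^{1/2},$$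 and in a neighbourhood of $[0,1]^m$ the objective functional $\mathcal{J}$, its gradient and its Hessian matrix satisfy $$\mathcal{J}(w)=\operatorname{tr}(\mathcal{C}_0)-\operatorname{tr}(C)+\operatorname{tr}(L_w^{-1}C)\in\mathbb{R},$$ $$\nabla\mathcal{J}(w)=\Big(-\big|C^{1/2}L_w^{-1}Re_k\big|^2\Big)_{k=1}^m\in\mathbb{R}^m,$$ $$H_{\mathcal{J}}(w)=2\big[R^TL_w^{-1}CL_w^{-1}R\big]\odot\big[R^TL_w^{-1}R\big]\in\mathbb{R}^{m\times m}.$$ Here $\odot$ is the Schur (Hadamard, elementwise) product of matrices of equal size, $(A\odot B)_{lk}=A_{lk}B_{lk}$, and $e_k\in\mathbb{R}^m$ is the $k$-th unit vector.
   Context: $m,n\in\mathbb{N}$; $\operatorname{Diag}(w)$ is the diagonal matrix with the vector $w$ on its diagonal; $I$ is the $n\times n$ and $I_\ell$ the $\ell\times\ell$ identity matrix; $|\cdot|$ is the Euclidean norm. Discretised Bayesian setting. Let $\Omega\subseteq\mathbb{R}^d$ be a compact domain. The undiscretised prior covariance on $L^2(\Omega)$ is of the form $\mathfrak{K}^{-2}$, two applications of a self-adjoint PDE solution operator, for a densely defined differential operator $\mathfrak{K}$ on $L^2(\Omega)$. Let $(\phi_i)_{i=1}^n\subset L^2(\Omega)\cap\operatorname{dom}(\mathfrak{K})$ be linearly independent Lagrange basis functions, and let $M,\mathbf{K}\in\mathbb{R}^{n\times n}$ be the mass and stiffness matrices, $M_{ij}=\int_\Omega\phi_i\phi_j\,dx$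 and $\mathbf{K}_{ij}=\int_\Omega\phi_i\mathfrak{K}\phi_j\,dx$. Let $M=(M^{1/2})^TM^{1/2}$ be a decomposition of $M$ with $M^{1/2}\in\mathbb{R}^{n\times n}$, and $M^{-1/2}:=(M^{1/2})^{-1}$. $\mathbb{R}^n_M$ denotes $\mathbb{R}^n$ with inner product $(a,a')_M:=a^TMa'$. The discretised prior covariance is $\mathcal{C}_0=\mathcal{C}_0^{1/2}\mathcal{C}_0^{1/2}:=\mathbf{K}^{-1}M\mathbf{K}^{-1}M$ on $\mathbb{R}^n_M$, with $\mathcal{C}_0^{1/2}=\mathbf{K}^{-1}M$. The discretised parameter-to-observable map is a linear map $\mathcal{F}:\mathbb{R}^n_M\to\mathbb{R}^m$, with adjoint $\mathcal{F}^*=M^{-1}\mathcal{F}^T$ ($\mathcal{F}^T$ the transpose of its matrix). A design $w$ (originally $w\in\{0,1\}^m$, $w_k=1$ meaning that the $k$-th of $m$ candidate sensors is placed; relaxed to $w\in[0,1]^m$ for optimisation) enters through $\mathcal{F}_w:=\operatorname{Diag}(w)\mathcal{F}$. Data are modelled as $g=\mathcal{F}_wf+\epsilon\in\mathbb{R}^m$ with unknown $f$ and Gaussian noise $\epsilon\sim\mathcal{N}(0,\Gamma)$, $\Gamma=\operatorname{Diag}(\sigma)\in\mathbb{R}^{m\times m}$, $\sigma\in\mathbb{R}^m$, $\sigma>0$ componentwise. Given data $g$ and prior $\mathcal{N}(m_0,\mathcal{C}_0)$, the posterior distribution of $f$ is $\mathcal{N}(m_{\mathrm{post}}(w),\mathcal{C}_{\mathrm{post}}(w))$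 with $$m_{\mathrm{post}}(w)=m_0+\mathcal{C}_{\mathrm{post}}(w)\mathcal{F}_w^*\Gamma^{-1}(g-\mathcal{F}_wm_0),\qquad \mathcal{C}_{\mathrm{post}}(w)=\big(\mathcal{F}^*\Gamma^{-1/2}\operatorname{Diag}(w)\Gamma^{-1/2}\mathcal{F}+\mathcal{C}_0^{-1}\big)^{-1}.$$
   Formalization: The formula for m_post(w) fails in general (e.g. w=0, g≠0). It is proved as printed for binary w with Diag(w)g=g; for binary w with g replaced by Diag(w)g; and for all w near [0,1]^m with g replaced by Diag(w)(g+(I-Diag(w))𝓕m_0). *)

theory Defs
  imports "HOL-Analysis.Analysis"
begin

section \<open>The undiscretised setting on \<open>L\<^sup>2(\<Omega>)\<close>\<close>

text \<open>
  Elements of \<open>L\<^sup>2(\<Omega>)\<close> are handled through representatives; \<open>ae_eq\<close> is equality in \<open>L\<^sup>2(\<Omega>)\<close>.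
\<close>

definition L2 :: "(real^'d) set \<Rightarrow> (real^'d \<Rightarrow> real) set" where
  "L2 \<Omega> = {u \<in> borel_measurable (lebesgue_on \<Omega>). integrable (lebesgue_on \<Omega>) (\<lambda>x. (u x)\<^sup>2)}"

definition L2_inner :: "(real^'d) set \<Rightarrow> (real^'d \<Rightarrow> real) \<Rightarrow> (real^'d \<Rightarrow> real) \<Rightarrow> real" where
  "L2_inner \<Omega> u v = (LINT x|lebesgue_on \<Omega>. u x * v x)"

definition ae_eq :: "(real^'d) set \<Rightarrow> (real^'d \<Rightarrow> real) \<Rightarrow> (real^'d \<Rightarrow> real) \<Rightarrow> bool" where
  "ae_eq \<Omega> u v \<longleftrightarrow> (AE x in lebesgue_on \<Omega>. u x = v x)"

definition densely_defined_operator ::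
    "(real^'d) set \<Rightarrow> (real^'d \<Rightarrow> real) set \<Rightarrow> ((real^'d \<Rightarrow> real) \<Rightarrow> (real^'d \<Rightarrow> real)) \<Rightarrow> bool" where
  "densely_defined_operator \<Omega> D A \<longleftrightarrow>
     D \<subseteq> L2 \<Omega> \<and> A \<in> D \<rightarrow> L2 \<Omega> \<and>
     (\<forall>u\<in>D. \<forall>v\<in>L2 \<Omega>. ae_eq \<Omega> u v \<longrightarrow> v \<in> D \<and> ae_eq \<Omega> (A u) (A v)) \<and>
     (\<forall>u\<in>D. \<forall>v\<in>D. \<forall>a b. (\<lambda>x. a * u x + b * v x) \<in> D \<and>
        ae_eq \<Omega> (A (\<lambda>x. a * u x + b * v x)) (\<lambda>x. a * A u x + b * A v x)) \<and>
     (\<forall>f\<in>L2 \<Omega>. \<forall>e>0. \<exists>u\<in>D. L2_inner \<Omega> (\<lambda>x. f x - u x) (\<lambda>x. f x - u x) < e)"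

text \<open>
  \<open>S\<close> is the inverse of the operator \<open>A\<close> with domain \<open>D\<close>, it is defined on all of \<open>L\<^sup>2(\<Omega>)\<close>, and it
  is self-adjoint (for an everywhere defined operator this is the same as being symmetric).
\<close>

definition self_adjoint_solution_operator ::
    "(real^'d) set \<Rightarrow> (real^'d \<Rightarrow> real) set \<Rightarrow> ((real^'d \<Rightarrow> real) \<Rightarrow> (real^'d \<Rightarrow> real)) \<Rightarrow>
     ((real^'d \<Rightarrow> real) \<Rightarrow> (real^'d \<Rightarrow> real)) \<Rightarrow> bool" where
  "self_adjoint_solution_operator \<Omega> D A S \<longleftrightarrow>
     (\<forall>f\<in>L2 \<Omega>. S f \<in> D \<and> ae_eq \<Omega> (A (S f)) f) \<and>
     (\<forall>u\<in>D. ae_eq \<Omega> (S (A u)) u) \<and>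
     (\<forall>f\<in>L2 \<Omega>. \<forall>g\<in>L2 \<Omega>. L2_inner \<Omega> (S f) g = L2_inner \<Omega> f (S g))"

definition L2_independent :: "(real^'d) set \<Rightarrow> ('n::finite \<Rightarrow> real^'d \<Rightarrow> real) \<Rightarrow> bool" where
  "L2_independent \<Omega> \<phi> \<longleftrightarrow>
     (\<forall>c. ae_eq \<Omega> (\<lambda>x. \<Sum>i\<in>UNIV. c i * \<phi> i x) (\<lambda>x. 0) \<longrightarrow> (\<forall>i. c i = 0))"

definition Lagrange_basis :: "(real^'d) set \<Rightarrow> ('n::finite \<Rightarrow> real^'d \<Rightarrow> real) \<Rightarrow> bool" where
  "Lagrange_basis \<Omega> \<phi> \<longleftrightarrow>
     (\<exists>node. range node \<subseteq> \<Omega> \<and> (\<forall>i j. \<phi> i (node j) = (if i = j then 1 else 0)))"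

definition mass_matrix :: "(real^'d) set \<Rightarrow> ('n::finite \<Rightarrow> real^'d \<Rightarrow> real) \<Rightarrow> real^'n^'n" where
  "mass_matrix \<Omega> \<phi> = (\<chi> i j. L2_inner \<Omega> (\<phi> i) (\<phi> j))"

definition stiffness_matrix ::
    "(real^'d) set \<Rightarrow> ((real^'d \<Rightarrow> real) \<Rightarrow> (real^'d \<Rightarrow> real)) \<Rightarrow>
     ('n::finite \<Rightarrow> real^'d \<Rightarrow> real) \<Rightarrow> real^'n^'n" where
  "stiffness_matrix \<Omega> A \<phi> = (\<chi> i j. L2_inner \<Omega> (\<phi> i) (A (\<phi> j)))"


section \<open>Matrices\<close>

definition Diag :: "real^'m \<Rightarrow> real^'m^'m" where
  "Diag w = (\<chi> i j. if i = j then w $ i else 0)"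

definition Hadamard :: "real^'k^'l \<Rightarrow> real^'k^'l \<Rightarrow> real^'k^'l"  (infixl \<open>\<odot>\<close> 70) where
  "A \<odot> B = (\<chi> i j. A $ i $ j * B $ i $ j)"

text \<open>
  Row and column indices live in different linearly ordered finite types, so they are compared
  through their positions, the number of smaller indices.
\<close>

definition upper_triangular ::
    "real^('m::{finite,linorder})^('l::{finite,linorder}) \<Rightarrow> bool" where
  "upper_triangular R \<longleftrightarrow> (\<forall>i j. card {..<j} < card {..<i} \<longrightarrow> R $ i $ j = 0)"

text \<open>The adjoint of \<open>A\<close> with respect to \<open>(a, a')\<^sub>M = a\<^sup>T M a'\<close> on its domain.\<close>

definition adjoint_M :: "real^'n^'n \<Rightarrow> real^'n^'m \<Rightarrow> real^'m^'n" where
  "adjoint_M M A = matrix_inv M ** transpose A"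


section \<open>The discretised Bayesian problem\<close>

definition prior_cov_sqrt :: "real^'n^'n \<Rightarrow> real^'n^'n \<Rightarrow> real^'n^'n" where
  "prior_cov_sqrt M K = matrix_inv K ** M"

definition prior_cov :: "real^'n^'n \<Rightarrow> real^'n^'n \<Rightarrow> real^'n^'n" where
  "prior_cov M K = prior_cov_sqrt M K ** prior_cov_sqrt M K"

definition noise_cov :: "real^'m \<Rightarrow> real^'m^'m" where
  "noise_cov \<sigma> = Diag \<sigma>"

definition noise_inv_sqrt :: "real^'m \<Rightarrow> real^'m^'m" where
  "noise_inv_sqrt \<sigma> = Diag (\<chi> k. 1 / sqrt (\<sigma> $ k))"

definition design_map :: "real^'n^'m \<Rightarrow> real^'m \<Rightarrow> real^'n^'m" where
  "design_map \<F> w = Diag w ** \<F>"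

text \<open>
  The posterior precision is linear in \<open>w\<close> and agrees with \<open>\<F>\<^sub>w\<^sup>* \<Gamma>\<^sup>-\<^sup>1 \<F>\<^sub>w + C\<^sub>0\<^sup>-\<^sup>1\<close>
  (\<open>\<F>\<^sub>w\<close> is \<open>design_map \<F> w\<close>) only if \<open>w\<close> is binary; the posterior mean is built from \<open>\<F>\<^sub>w\<close>
  itself, hence contains terms quadratic in \<open>w\<close>.
\<close>

definition post_precision ::
    "real^'n^'n \<Rightarrow> real^'n^'n \<Rightarrow> real^'n^'m \<Rightarrow> real^'m \<Rightarrow> real^'m \<Rightarrow> real^'n^'n" where
  "post_precision M K \<F> \<sigma> w =
     adjoint_M M \<F> ** noise_inv_sqrt \<sigma> ** Diag w ** noise_inv_sqrt \<sigma> ** \<F>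
     + matrix_inv (prior_cov M K)"

definition post_cov ::
    "real^'n^'n \<Rightarrow> real^'n^'n \<Rightarrow> real^'n^'m \<Rightarrow> real^'m \<Rightarrow> real^'m \<Rightarrow> real^'n^'n" where
  "post_cov M K \<F> \<sigma> w = matrix_inv (post_precision M K \<F> \<sigma> w)"

definition post_mean ::
    "real^'n^'n \<Rightarrow> real^'n^'n \<Rightarrow> real^'n^'m \<Rightarrow> real^'m \<Rightarrow> real^'m \<Rightarrow> real^'n \<Rightarrow> real^'m \<Rightarrow> real^'n" where
  "post_mean M K \<F> \<sigma> g m0 w =
     m0 + (post_cov M K \<F> \<sigma> w ** adjoint_M M (design_map \<F> w) ** matrix_inv (noise_cov \<sigma>))
            *v (g - design_map \<F> w *v m0)"

definition A_objective ::
    "real^'n^'n \<Rightarrow> real^'n^'n \<Rightarrow> real^'n^'m \<Rightarrow> real^'m \<Rightarrow> real^'m \<Rightarrow> real" where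
  "A_objective M K \<F> \<sigma> w = trace (post_cov M K \<F> \<sigma> w)"

text \<open>The gradient exists near \<open>x\<close>, is differentiable at \<open>x\<close>, and its Jacobian matrix there is \<open>H\<close>.\<close>

definition has_Hessian :: "(real^'m \<Rightarrow> real) \<Rightarrow> real^'m^'m \<Rightarrow> real^'m \<Rightarrow> bool" where
  "has_Hessian f H x \<longleftrightarrow>
     (\<exists>G. (\<forall>\<^sub>F y in nhds x. GDERIV f y :> G y) \<and> (G has_derivative (\<lambda>h. H *v h)) (at x))"

end

theory Submission
  imports Defs
begin

text \<open>
  Write \<open>B = C\<^sub>0\<^sup>1\<^sup>/\<^sup>2 M\<^sup>-\<^sup>1\<^sup>/\<^sup>2\<close> and \<open>B' = M\<^sup>1\<^sup>/\<^sup>2 C\<^sub>0\<^sup>1\<^sup>/\<^sup>2\<close>. Self-adjointness of the solution operator makes the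
  stiffness matrix symmetric, and then \<open>B'\<close> is the adjoint of \<open>B\<close>, so that multiplying the posterior
  precision by \<open>B'\<close> from the left and by \<open>B\<close> from the right whitens it: the result is
  \<open>X\<^sub>w = F\<^sup>T Diag(w) F + I\<close> (\<open>post_precision_whitened\<close>). Hence \<open>C\<^sub>p\<^sub>o\<^sub>s\<^sub>t = B X\<^sub>w\<^sup>-\<^sup>1 B'\<close>.

  Inserting \<open>F\<^sup>T = Q R\<close> gives \<open>X\<^sub>w = Q (R Diag(w) R\<^sup>T) Q\<^sup>T + I\<close>, which acts as \<open>L\<^sub>w\<close> on the range
  of \<open>Q\<close> and as the identity on its orthogonal complement. So \<open>X\<^sub>w\<^sup>-\<^sup>1 = I - Q Q\<^sup>T + Q L\<^sub>w\<^sup>-\<^sup>1 Q\<^sup>T\<close> and \<open>X\<^sub>w\<^sup>-\<^sup>1 Q = Q L\<^sub>w\<^sup>-\<^sup>1\<close>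
  (\<open>matrix_inv_low_rank_plus_identity\<close>). The first identity yields the posterior covariance and, by
  cyclicity of the trace, the objective; the second one yields the gain matrix
  \<open>B X\<^sub>w\<^sup>-\<^sup>1 F\<^sup>T = B Q L\<^sub>w\<^sup>-\<^sup>1 R\<close> in the posterior mean.

  What depends on \<open>w\<close> in the objective is \<open>tr (L\<^sub>w\<^sup>-\<^sup>1 C)\<close> with \<open>L\<^sub>w\<close> affine in \<open>w\<close>, so gradient and Hessian
  follow by applying the derivative \<open>H \<mapsto> - N H N\<close> of the matrix inverse, at the matrix with inverse \<open>N\<close>,
  once and twice. All of this holds on the set of those \<open>w\<close> for which \<open>L\<^sub>w\<close> is invertible. It is open
  because inversion is stable under small perturbations, and it contains \<open>[0, 1]\<^sup>m\<close> because there
  \<open>L\<^sub>w\<close> is positive definite.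
\<close>


section \<open>Matrix algebra\<close>

lemma invertible_matrix_inv_right: "invertible A \<Longrightarrow> A ** matrix_inv A = mat 1"
  and invertible_matrix_inv_left: "invertible A \<Longrightarrow> matrix_inv A ** A = mat 1"
  for A :: "real^'n^'n"
proof -
  have "A ** matrix_inv A = mat 1 \<and> matrix_inv A ** A = mat 1" if "invertible A" for A :: "real^'n^'n"
    using that unfolding invertible_def matrix_inv_def by (rule someI_ex)
  then show "invertible A \<Longrightarrow> A ** matrix_inv A = mat 1" "invertible A \<Longrightarrow> matrix_inv A ** A = mat 1"
    by auto
qed

lemma matrix_inv_unique_right:
  fixes A B :: "real^'n^'n"
  assumes "A ** B = mat 1"
  shows "invertible A" and "matrix_inv A = B"
proof -
  show inv: "invertible A"
    using assms invertible_right_inverse by blast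
  have "matrix_inv A ** (A ** B) = B"
    by (simp add: matrix_mul_assoc invertible_matrix_inv_left[OF inv])
  then show "matrix_inv A = B"
    by (simp add: assms)
qed

lemma transpose_matrix_inv:
  fixes A :: "real^'n^'n"
  assumes "invertible A"
  shows "transpose (matrix_inv A) = matrix_inv (transpose A)"
  by (metis assms invertible_matrix_inv_left matrix_inv_unique_right(2) matrix_transpose_mul transpose_mat)

lemma transpose_matrix_add: "transpose (A + B) = transpose A + transpose B"
  by (simp add: vec_eq_iff transpose_def)

lemma matrix_add_rdistrib: "(A + B) ** C = A ** C + B ** C" for A B :: "real^'n^'m"
  by (simp add: vec_eq_iff matrix_matrix_mult_def sum.distrib distrib_right)

lemma bounded_bilinear_matrix_mult:
  "bounded_bilinear ((**) :: real^'n^'m \<Rightarrow> real^'k^'n \<Rightarrow> real^'k^'m)"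
  unfolding bilinear_conv_bounded_bilinear[symmetric] bilinear_def
  by (auto intro!: linearI simp: matrix_add_ldistrib matrix_add_rdistrib
      matrix_scalar_ac scalar_matrix_assoc)

lemmas matrix_diff_left = bounded_bilinear.diff_left[OF bounded_bilinear_matrix_mult]
  and matrix_diff_right = bounded_bilinear.diff_right[OF bounded_bilinear_matrix_mult]
  and matrix_minus_left = bounded_bilinear.minus_left[OF bounded_bilinear_matrix_mult]
  and matrix_minus_right = bounded_bilinear.minus_right[OF bounded_bilinear_matrix_mult]

lemma Diag_mult_Diag: "Diag v ** Diag w = Diag (v * w)"
  by (simp add: vec_eq_iff Diag_def matrix_matrix_mult_def if_distrib[of "\<lambda>c. c * _"] cong: if_cong)

lemma Diag_commute: "Diag v ** Diag w = Diag w ** Diag v" for v w :: "real^'m"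
  by (simp add: Diag_mult_Diag mult.commute)

lemma Diag_idempotent: "\<forall>k. w $ k \<in> {0, 1} \<Longrightarrow> Diag w ** Diag w = Diag w"
  unfolding Diag_mult_Diag by (rule arg_cong[of _ _ Diag]) (auto simp: vec_eq_iff)

lemma transpose_Diag: "transpose (Diag w) = Diag w"
  by (simp add: vec_eq_iff Diag_def transpose_def)

lemma Diag_mult_vector_nth: "(Diag w *v x) $ k = w $ k * x $ k"
  by (simp add: Diag_def matrix_vector_mult_def if_distrib[of "\<lambda>c. c * _"] cong: if_cong)

lemma mult_Diag_mult_nth: "(A ** Diag h ** B) $ i $ j = (\<Sum>k\<in>UNIV. A $ i $ k * h $ k * B $ k $ j)"
  by (simp add: Diag_def matrix_matrix_mult_def if_distrib cong: if_cong)

lemma trace_Diag_mult: "trace (Diag h ** A) = (\<Sum>k\<in>UNIV. h $ k * A $ k $ k)"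
  by (simp add: trace_def Diag_def matrix_matrix_mult_def if_distrib[of "\<lambda>c. c * _"] cong: if_cong)

lemma bounded_linear_Diag: "bounded_linear (Diag :: real^'m \<Rightarrow> _)"
  unfolding linear_conv_bounded_linear[symmetric]
  by (auto intro!: linearI simp: vec_eq_iff Diag_def)

lemma bounded_linear_trace: "bounded_linear (trace :: real^'n^'n \<Rightarrow> real)"
  unfolding linear_conv_bounded_linear[symmetric]
  by (auto intro!: linearI simp: trace_def sum.distrib sum_distrib_left)

lemma Gram_diagonal: "(transpose A ** A) $ k $ k = (norm (A *v axis k 1))\<^sup>2"
  for A :: "real^'n^'m"
  by (simp add: power2_norm_eq_inner inner_vec_def matrix_matrix_mult_def transpose_def
      matrix_vector_mult_basis column_def)

text \<open>
  Such a factorisation may be solved for \<open>P\<^sup>-\<^sup>1\<close> without knowing that the outer factors are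
  invertible: \<open>X\<^sup>-\<^sup>1 B'\<close> is a left inverse of \<open>P B\<close>, and for square matrices left inverses are right
  inverses.
\<close>

lemma matrix_inv_factorised:
  fixes P X B B' :: "real^'n^'n"
  assumes BPB: "B' ** P ** B = X" and X: "invertible X"
  shows "invertible P" and "matrix_inv P = B ** matrix_inv X ** B'"
proof -
  have "(matrix_inv X ** B') ** (P ** B) = mat 1"
    using invertible_matrix_inv_left[OF X] BPB by (simp add: matrix_mul_assoc[symmetric])
  then have "(P ** B) ** (matrix_inv X ** B') = mat 1"
    by (simp only: matrix_left_right_inverse[of "P ** B"])
  then have "P ** (B ** matrix_inv X ** B') = mat 1"
    by (simp only: matrix_mul_assoc)
  then show "invertible P" "matrix_inv P = B ** matrix_inv X ** B'"
    by (rule matrix_inv_unique_right)+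
qed

text \<open>
  The matrix \<open>Q A Q\<^sup>T + I\<close> is block diagonal: it acts as \<open>A + I\<close> on the range of \<open>Q\<close>, with the columns of
  \<open>Q\<close> as orthonormal basis, and as the identity on the orthogonal complement. So its inverse is the
  projection \<open>I - Q Q\<^sup>T\<close> plus the lift of \<open>(A + I)\<^sup>-\<^sup>1\<close>. This is what replaces an inversion in dimension
  \<open>n\<close> by one in dimension \<open>l\<close>.
\<close>

lemma matrix_inv_low_rank_plus_identity:
  fixes Q :: "real^'l^'n" and A :: "real^'l^'l"
  assumes Q: "transpose Q ** Q = mat 1" and A: "invertible (A + mat 1)"
  defines "X \<equiv> Q ** A ** transpose Q + mat 1"
  shows "invertible X"
    and "matrix_inv X = mat 1 - Q ** transpose Q + Q ** matrix_inv (A + mat 1) ** transpose Q"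
    and "matrix_inv X ** Q = Q ** matrix_inv (A + mat 1)"
proof -
  let ?N = "matrix_inv (A + mat 1)"
  let ?Y = "mat 1 - Q ** transpose Q + Q ** ?N ** transpose Q"
  have cancel: "transpose Q ** (Q ** Z) = Z" for Z :: "real^'k^'l"
    by (simp add: matrix_mul_assoc Q)
  have AN: "A ** (?N ** Z) = Z - ?N ** Z" for Z :: "real^'k^'l"
  proof -
    have "(A + mat 1) ** (?N ** Z) = Z"
      by (simp add: matrix_mul_assoc invertible_matrix_inv_right[OF A])
    then show ?thesis
      unfolding matrix_add_rdistrib by (simp add: eq_diff_eq)
  qed
  have XY: "X ** ?Y = mat 1"
    by (simp add: X_def matrix_add_ldistrib matrix_add_rdistrib matrix_diff_left
        matrix_diff_right cancel AN Q flip: matrix_mul_assoc)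
  show "invertible X" "matrix_inv X = ?Y"
    using matrix_inv_unique_right[OF XY] by auto
  then show "matrix_inv X ** Q = Q ** ?N"
    by (simp add: matrix_add_rdistrib matrix_diff_left cancel Q flip: matrix_mul_assoc)
qed


section \<open>Continuity and derivative of the matrix inverse\<close>

lemma tendsto_det:
  fixes A :: "'a \<Rightarrow> real^'n^'n"
  assumes "\<And>i j. ((\<lambda>x. A x $ i $ j) \<longlongrightarrow> B $ i $ j) F"
  shows "((\<lambda>x. det (A x)) \<longlongrightarrow> det B) F"
  unfolding det_def by (intro tendsto_intros assms)

text \<open>
  By Cramer's rule the entries of the inverse are quotients of determinants, hence of continuous
  functions of the entries, as long as the determinant in the denominator does not vanish.
\<close>

lemma tendsto_matrix_inv:
  fixes A :: "'a \<Rightarrow> real^'n^'n"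
  assumes lim: "(A \<longlongrightarrow> B) F" and B: "invertible B"
  shows "((\<lambda>x. matrix_inv (A x)) \<longlongrightarrow> matrix_inv B) F"
    and "\<forall>\<^sub>F x in F. invertible (A x)"
proof -
  have entry: "((\<lambda>x. A x $ i $ j) \<longlongrightarrow> B $ i $ j) F" for i j
    by (intro tendsto_vec_nth lim)
  have "((\<lambda>x. det (A x)) \<longlongrightarrow> det B) F" by (intro tendsto_det entry)
  moreover have detB: "det B \<noteq> 0" using B by (simp add: invertible_det_nz)
  ultimately have "\<forall>\<^sub>F x in F. det (A x) \<noteq> 0"
    by (rule tendsto_imp_eventually_ne)
  then show ev: "\<forall>\<^sub>F x in F. invertible (A x)"
    by (simp add: invertible_det_nz)
  define cof :: "real^'n^'n \<Rightarrow> 'n \<Rightarrow> 'n \<Rightarrow> real"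
    where "cof Z i j = det (\<chi> k l. if l = i then axis j 1 $ k else Z $ k $ l)" for Z i j
  have cramer_inv: "matrix_inv Z $ i $ j = cof Z i j / det Z" if "invertible Z" for Z i j
  proof -
    have "Z *v (matrix_inv Z *v axis j 1) = axis j 1"
      by (simp add: matrix_vector_mul_assoc invertible_matrix_inv_right[OF that])
    then have "matrix_inv Z *v axis j 1 = (\<chi> i. cof Z i j / det Z)"
      using that by (simp add: cramer invertible_det_nz cof_def)
    then have "(matrix_inv Z *v axis j 1) $ i = cof Z i j / det Z" by simp
    then show ?thesis by (simp add: matrix_vector_mul_component inner_axis)
  qed
  have "((\<lambda>x. matrix_inv (A x) $ i $ j) \<longlongrightarrow> matrix_inv B $ i $ j) F" for i j
  proof (rule Lim_transform_eventually)
    show "((\<lambda>x. cof (A x) i j / det (A x)) \<longlongrightarrow> matrix_inv B $ i $ j) F"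
      unfolding cramer_inv[OF B] cof_def
      by (intro tendsto_divide tendsto_det detB entry) (auto intro: entry)
    show "\<forall>\<^sub>F x in F. cof (A x) i j / det (A x) = matrix_inv (A x) $ i $ j"
      using ev by eventually_elim (simp add: cramer_inv)
  qed
  then show "((\<lambda>x. matrix_inv (A x)) \<longlongrightarrow> matrix_inv B) F"
    by (intro vec_tendstoI)
qed

lemma open_invertible_preimage:
  fixes A :: "real^'m \<Rightarrow> real^'n^'n"
  assumes "continuous_on UNIV A"
  shows "open {w. invertible (A w)}"
proof (subst open_subopen, intro ballI)
  fix w assume "w \<in> {w. invertible (A w)}"
  moreover have "(A \<longlongrightarrow> A w) (nhds w)"
    using assms by (simp add: continuous_on_eq_continuous_at continuous_at tendsto_at_iff_tendsto_nhds)
  ultimately have "\<forall>\<^sub>F v in nhds w. invertible (A v)"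
    by (intro tendsto_matrix_inv(2)) auto
  then show "\<exists>T. open T \<and> w \<in> T \<and> T \<subseteq> {w. invertible (A w)}"
    unfolding eventually_nhds by blast
qed

text \<open>
  With \<open>N = B\<^sup>-\<^sup>1\<close>, the resolvent identity \<open>Z\<^sup>-\<^sup>1 - N = - Z\<^sup>-\<^sup>1 (Z - B) N\<close> is the claimed first-order
  expansion except that \<open>Z\<^sup>-\<^sup>1\<close> stands in place of \<open>N\<close>. The error \<open>(N - Z\<^sup>-\<^sup>1) (Z - B) N\<close> is of lower order
  because the inverse is continuous.
\<close>

lemma has_derivative_matrix_inv:
  fixes B :: "real^'n^'n"
  assumes B: "invertible B"
  shows "(matrix_inv has_derivative (\<lambda>H. - (matrix_inv B ** H ** matrix_inv B))) (at B)"
proof -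
  interpret mm: bounded_bilinear "(**) :: real^'n^'n \<Rightarrow> real^'n^'n \<Rightarrow> real^'n^'n"
    by (rule bounded_bilinear_matrix_mult)
  obtain c where c: "c > 0" "\<And>(X :: real^'n^'n) (Y :: real^'n^'n). norm (X ** Y) \<le> norm X * norm Y * c"
    using mm.pos_bounded by blast
  let ?N = "matrix_inv B"
  have lim: "(matrix_inv \<longlongrightarrow> ?N) (at B)" and ev: "\<forall>\<^sub>F Z in at B. invertible Z"
    using tendsto_matrix_inv[OF tendsto_ident_at B] by auto
  show ?thesis
    unfolding has_derivative_iff_norm
  proof
    show "bounded_linear (\<lambda>H. - (?N ** H ** ?N))"
      by (intro bounded_linear_minus mm.bounded_linear_left
          bounded_linear_compose[OF mm.bounded_linear_left mm.bounded_linear_right])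
    let ?e = "\<lambda>Z. norm (matrix_inv Z - ?N - - (?N ** (Z - B) ** ?N)) / norm (Z - B)"
    show "(?e \<longlongrightarrow> 0) (at B)"
    proof (rule tendsto_sandwich[OF _ _ tendsto_const])
      show "\<forall>\<^sub>F Z in at B. 0 \<le> ?e Z" by simp
      show "((\<lambda>Z. norm (?N - matrix_inv Z) * c * norm ?N * c) \<longlongrightarrow> 0) (at B)"
        by (rule tendsto_eq_rhs, (rule tendsto_intros lim)+) simp
      show "\<forall>\<^sub>F Z in at B. ?e Z \<le> norm (?N - matrix_inv Z) * c * norm ?N * c"
        using ev eventually_neq_at_within[of B]
      proof eventually_elim
        case (elim Z)
        have "matrix_inv Z ** (Z - B) ** ?N = (matrix_inv Z ** Z) ** ?N - matrix_inv Z ** (B ** ?N)"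
          by (simp only: mm.diff_left mm.diff_right matrix_mul_assoc)
        also have "\<dots> = ?N - matrix_inv Z"
          by (simp only: invertible_matrix_inv_left[OF elim(1)] invertible_matrix_inv_right[OF B]
              matrix_mul_lid matrix_mul_rid)
        finally have ZI: "matrix_inv Z - ?N = - (matrix_inv Z ** (Z - B) ** ?N)" by simp
        have "matrix_inv Z - ?N - - (?N ** (Z - B) ** ?N) = (?N - matrix_inv Z) ** (Z - B) ** ?N"
          unfolding ZI by (simp add: mm.diff_left)
        also have "norm \<dots> \<le> norm ((?N - matrix_inv Z) ** (Z - B)) * norm ?N * c" by (rule c)
        also have "\<dots> \<le> (norm (?N - matrix_inv Z) * norm (Z - B) * c) * norm ?N * c"
          using c by (intro mult_right_mono) auto
        finally have "norm (matrix_inv Z - ?N - - (?N ** (Z - B) ** ?N))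
            \<le> (norm (?N - matrix_inv Z) * c * norm ?N * c) * norm (Z - B)"
          by (simp only: ac_simps)
        moreover have "norm (Z - B) > 0" using elim(2) by simp
        ultimately show ?case by (simp only: pos_divide_le_eq)
      qed
    qed
  qed
qed


section \<open>The reduced precision matrix and the trace of its inverse\<close>

text \<open>
  The matrix \<open>L\<^sub>w\<close>. It represents the whitened posterior precision on the range of \<open>Q\<close>, with respect to
  the orthonormal basis formed by the columns of \<open>Q\<close>; outside of this range the data carry no
  information.
\<close>

definition reduced_precision :: "real^'m^'l \<Rightarrow> real^'m \<Rightarrow> real^'l^'l" where
  "reduced_precision R w = R ** Diag w ** transpose R + mat 1"

text \<open>
  For nonnegative weights the matrix is at least the identity in the Loewner order:
  \<open>x\<^sup>T L\<^sub>w x = |x|\<^sup>2 + (\<Sum>k. w\<^sub>k (R\<^sup>T x)\<^sub>k\<^sup>2)\<close>.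
\<close>

lemma invertible_reduced_precision:
  fixes R :: "real^'m^'l"
  assumes "\<And>k. 0 \<le> w $ k"
  shows "invertible (reduced_precision R w)"
proof -
  have "x = 0" if "reduced_precision R w *v x = 0" for x :: "real^'l"
  proof -
    let ?y = "transpose R *v x"
    have "0 = x \<bullet> (reduced_precision R w *v x)"
      using that by simp
    also have "\<dots> = ?y \<bullet> (Diag w *v ?y) + x \<bullet> x"
      by (simp add: reduced_precision_def matrix_vector_mult_add_rdistrib inner_add_right dot_lmul_matrix
          flip: matrix_vector_mul_assoc)
    also have "?y \<bullet> (Diag w *v ?y) = (\<Sum>k\<in>UNIV. w $ k * (?y $ k)\<^sup>2)"
      by (simp only: inner_vec_def Diag_mult_vector_nth inner_real_def power2_eq_square ac_simps)
    finally have "x \<bullet> x = - (\<Sum>k\<in>UNIV. w $ k * (?y $ k)\<^sup>2)" by simp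
    also have "\<dots> \<le> 0" using assms by (simp add: sum_nonneg)
    finally show ?thesis using inner_ge_zero[of x] inner_eq_zero_iff[of x] by linarith
  qed
  then show ?thesis
    using matrix_left_invertible_ker invertible_left_inverse by blast
qed

lemma bounded_linear_sandwich: "bounded_linear (\<lambda>X. A ** X ** B)"
  for A :: "real^'b^'a" and B :: "real^'d^'c"
  by (rule bounded_linear_compose
      [OF bounded_bilinear.bounded_linear_left[OF bounded_bilinear_matrix_mult]
        bounded_bilinear.bounded_linear_right[OF bounded_bilinear_matrix_mult]])

lemma has_derivative_reduced_precision:
  "(reduced_precision R has_derivative (\<lambda>h. R ** Diag h ** transpose R)) (at w)"
  unfolding reduced_precision_def[abs_def]
  using has_derivative_add[OF bounded_linear_imp_has_derivative
      [OF bounded_linear_compose[OF bounded_linear_sandwich bounded_linear_Diag]] has_derivative_const]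
  by simp

lemma continuous_on_reduced_precision: "continuous_on UNIV (reduced_precision R)"
  by (rule has_derivative_continuous_on) (rule has_derivative_reduced_precision)

lemma transpose_reduced_precision: "transpose (reduced_precision R w) = reduced_precision R w"
  by (simp only: reduced_precision_def transpose_matrix_add matrix_transpose_mul transpose_Diag transpose_transpose
      transpose_mat matrix_mul_assoc)

lemma has_derivative_matrix_inv_reduced_precision:
  assumes "invertible (reduced_precision R w)"
  shows "((\<lambda>v. matrix_inv (reduced_precision R v)) has_derivative
    (\<lambda>h. - (matrix_inv (reduced_precision R w) ** (R ** Diag h ** transpose R)
      ** matrix_inv (reduced_precision R w)))) (at w)"
  by (rule has_derivative_compose[OF has_derivative_reduced_precision has_derivative_matrix_inv[OF assms]])

text \<open>
  With \<open>N = L\<^sub>w\<^sup>-\<^sup>1\<close>, the derivative in direction \<open>h\<close> is \<open>- tr (N R Diag(h) R\<^sup>T N C)\<close>. Moving \<open>N R\<close> cyclically to the end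
  leaves \<open>Diag(h)\<close> in front, so that only the diagonal of \<open>R\<^sup>T N C N R\<close> enters.
\<close>

lemma GDERIV_trace_inv_reduced_precision:
  fixes R :: "real^'m^'l"
  assumes "invertible (reduced_precision R w)"
  defines "N \<equiv> matrix_inv (reduced_precision R w)"
  shows "GDERIV (\<lambda>v. trace (matrix_inv (reduced_precision R v) ** C)) w :>
    (\<chi> k. - (transpose R ** N ** C ** N ** R) $ k $ k)"
proof -
  have "((\<lambda>v. trace (matrix_inv (reduced_precision R v) ** C)) has_derivative
      (\<lambda>h. trace (- (N ** (R ** Diag h ** transpose R) ** N) ** C))) (at w)"
    unfolding N_def
    by (rule bounded_linear.has_derivative[OF bounded_linear_compose[OF bounded_linear_trace
          bounded_bilinear.bounded_linear_left[OF bounded_bilinear_matrix_mult]]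
          has_derivative_matrix_inv_reduced_precision[OF assms(1)]])
  moreover have "trace (- (N ** (R ** Diag h ** transpose R) ** N) ** C) =
      h \<bullet> (\<chi> k. - (transpose R ** N ** C ** N ** R) $ k $ k)" for h
  proof -
    have "trace (N ** (R ** Diag h ** transpose R) ** N ** C)
        = trace ((N ** R) ** (Diag h ** transpose R ** N ** C))"
      by (simp only: matrix_mul_assoc)
    also have "\<dots> = trace (Diag h ** (transpose R ** N ** C ** N ** R))"
      unfolding trace_mul_sym[of "N ** R"] by (simp only: matrix_mul_assoc)
    finally have "trace (N ** (R ** Diag h ** transpose R) ** N ** C)
        = (\<Sum>k\<in>UNIV. h $ k * (transpose R ** N ** C ** N ** R) $ k $ k)"
      by (simp only: trace_Diag_mult)
    moreover have "trace (- (N ** (R ** Diag h ** transpose R) ** N) ** C)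
        = - trace (N ** (R ** Diag h ** transpose R) ** N ** C)"
      unfolding matrix_minus_left by (rule linear_neg[OF bounded_linear.linear[OF bounded_linear_trace]])
    ultimately show ?thesis
      by (simp add: inner_vec_def sum_negf)
  qed
  ultimately show ?thesis
    unfolding gderiv_def by simp
qed

text \<open>
  Put \<open>N = L\<^sub>w\<^sup>-\<^sup>1\<close>, \<open>S = R\<^sup>T N C N R\<close> and \<open>P = R\<^sup>T N R\<close>. Each of the two factors \<open>N\<close> in \<open>S\<close> contributes to the
  derivative, which is \<open>- (S Diag(h) P + P Diag(h) S)\<close>. The \<open>k\<close>-th diagonal entry of such a product is
  \<open>\<Sum>l. S\<^sub>k\<^sub>l h\<^sub>l P\<^sub>l\<^sub>k\<close>; as \<open>S\<close> and \<open>P\<close> are symmetric, both products contribute the same amount, which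
  produces the Hadamard product and the factor \<open>2\<close>.
\<close>

lemma has_derivative_gradient_trace_inv_reduced_precision:
  fixes R :: "real^'m^'l"
  assumes inv: "invertible (reduced_precision R w)" and C: "transpose C = C"
  defines "N \<equiv> \<lambda>v. matrix_inv (reduced_precision R v)"
  shows "((\<lambda>v. \<chi> k. - (transpose R ** N v ** C ** N v ** R) $ k $ k) has_derivative
    (\<lambda>h. (2 *\<^sub>R ((transpose R ** N w ** C ** N w ** R) \<odot> (transpose R ** N w ** R))) *v h)) (at w)"
proof -
  let ?S = "transpose R ** N w ** C ** N w ** R" and ?P = "transpose R ** N w ** R"
  have N': "(N has_derivative (\<lambda>h. - (N w ** (R ** Diag h ** transpose R) ** N w))) (at w)"
    unfolding N_def by (rule has_derivative_matrix_inv_reduced_precision[OF inv])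
  have "((\<lambda>v. N v ** C ** N v) has_derivative
      (\<lambda>h. (N w ** C) ** - (N w ** (R ** Diag h ** transpose R) ** N w)
        + (- (N w ** (R ** Diag h ** transpose R) ** N w) ** C) ** N w)) (at w)"
    by (intro bounded_bilinear.FDERIV[OF bounded_bilinear_matrix_mult]
        bounded_linear.has_derivative[OF bounded_bilinear.bounded_linear_left
          [OF bounded_bilinear_matrix_mult]] N')
  from bounded_linear.has_derivative[OF bounded_linear_sandwich this, of "transpose R" R]
  have S': "((\<lambda>v. transpose R ** N v ** C ** N v ** R) has_derivative
      (\<lambda>h. - (?S ** Diag h ** ?P) - ?P ** Diag h ** ?S)) (at w)"
    by (simp add: matrix_mul_assoc matrix_add_ldistrib matrix_add_rdistrib
        matrix_minus_left matrix_minus_right matrix_diff_left matrix_diff_right)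
  have N_sym: "transpose (N w) = N w"
    by (simp add: N_def transpose_matrix_inv inv transpose_reduced_precision)
  have "transpose ?S = ?S" "transpose ?P = ?P"
    by (simp_all only: matrix_transpose_mul transpose_transpose N_sym C matrix_mul_assoc)
  then have S_sym: "?S $ i $ j = ?S $ j $ i" and P_sym: "?P $ i $ j = ?P $ j $ i" for i j
    by (metis (no_types, lifting) transpose_def vec_lambda_beta)+
  have "((\<lambda>v. \<chi> k. - (transpose R ** N v ** C ** N v ** R) $ k $ k) has_derivative
      (\<lambda>h. \<chi> k. - (- (?S ** Diag h ** ?P) - ?P ** Diag h ** ?S) $ k $ k)) (at w)"
    by (rule bounded_linear.has_derivative[OF _ S'])
      (auto simp: linear_conv_bounded_linear[symmetric] vec_eq_iff intro!: linearI)
  moreover have "(\<chi> k. - (- (?S ** Diag h ** ?P) - ?P ** Diag h ** ?S) $ k $ k)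
      = (2 *\<^sub>R (?S \<odot> ?P)) *v h" for h
  proof -
    have "(?P ** Diag h ** ?S) $ k $ k + (?S ** Diag h ** ?P) $ k $ k
        = (\<Sum>l\<in>UNIV. 2 * (?S $ k $ l * ?P $ k $ l) * h $ l)" for k
      unfolding mult_Diag_mult_nth S_sym[of _ k] P_sym[of _ k] sum.distrib[symmetric]
      by (intro sum.cong refl) (simp add: algebra_simps)
    then show ?thesis
      by (simp add: vec_eq_iff matrix_vector_mult_def Hadamard_def)
  qed
  ultimately show ?thesis by simp
qed


section \<open>Mass and stiffness matrices\<close>

lemma L2_integrable_mult:
  assumes "u \<in> L2 \<Omega>" "v \<in> L2 \<Omega>"
  shows "integrable (lebesgue_on \<Omega>) (\<lambda>x. u x * v x)"
proof (rule Bochner_Integration.integrable_bound)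
  show "integrable (lebesgue_on \<Omega>) (\<lambda>x. (u x)\<^sup>2 + (v x)\<^sup>2)"
    using assms by (simp add: L2_def)
  show "(\<lambda>x. u x * v x) \<in> borel_measurable (lebesgue_on \<Omega>)"
    using assms by (intro borel_measurable_times) (simp_all add: L2_def)
  have "norm (u x * v x) \<le> norm ((u x)\<^sup>2 + (v x)\<^sup>2)" for x
  proof -
    have "2 * \<bar>u x\<bar> * \<bar>v x\<bar> \<le> (u x)\<^sup>2 + (v x)\<^sup>2"
      using sum_squares_bound[of "\<bar>u x\<bar>" "\<bar>v x\<bar>"] by simp
    moreover have "0 \<le> \<bar>u x\<bar> * \<bar>v x\<bar>" by simp
    ultimately have "\<bar>u x\<bar> * \<bar>v x\<bar> \<le> (u x)\<^sup>2 + (v x)\<^sup>2" by linarith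
    then show ?thesis by (simp add: abs_mult)
  qed
  then show "AE x in lebesgue_on \<Omega>. norm (u x * v x) \<le> norm ((u x)\<^sup>2 + (v x)\<^sup>2)"
    by simp
qed

text \<open>
  The mass matrix is a Gram matrix: \<open>c\<^sup>T M c\<close> is the squared norm in \<open>L\<^sup>2(\<Omega>)\<close> of \<open>\<Sum>i. c\<^sub>i \<phi>\<^sub>i\<close>, and this
  vanishes only for \<open>c = 0\<close>.
\<close>

lemma invertible_mass_matrix:
  fixes \<phi> :: "'n::finite \<Rightarrow> real^'d \<Rightarrow> real"
  assumes L2: "\<And>i. \<phi> i \<in> L2 \<Omega>" and indep: "L2_independent \<Omega> \<phi>"
  shows "invertible (mass_matrix \<Omega> \<phi>)"
proof -
  have "c = 0" if c: "mass_matrix \<Omega> \<phi> *v c = 0" for c :: "real^'n"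
  proof -
    let ?u = "\<lambda>x. \<Sum>i\<in>UNIV. c $ i * \<phi> i x"
    let ?p = "\<lambda>i j x. c $ i * c $ j * (\<phi> i x * \<phi> j x)"
    have int: "integrable (lebesgue_on \<Omega>) (?p i j)" for i j
      by (intro integrable_mult_right L2_integrable_mult L2)
    have sq: "(\<lambda>x. (?u x)\<^sup>2) = (\<lambda>x. \<Sum>i\<in>UNIV. \<Sum>j\<in>UNIV. ?p i j x)"
      by (simp add: power2_eq_square sum_product ac_simps)
    have "(LINT x|lebesgue_on \<Omega>. (?u x)\<^sup>2) = (\<Sum>i\<in>UNIV. \<Sum>j\<in>UNIV. LINT x|lebesgue_on \<Omega>. ?p i j x)"
      unfolding sq Bochner_Integration.integral_sum[OF Bochner_Integration.integrable_sum[OF int]]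
      by (intro sum.cong refl Bochner_Integration.integral_sum int)
    also have "\<dots> = (\<Sum>i\<in>UNIV. \<Sum>j\<in>UNIV. c $ i * c $ j * L2_inner \<Omega> (\<phi> i) (\<phi> j))"
      by (simp add: L2_inner_def)
    also have "\<dots> = c \<bullet> (mass_matrix \<Omega> \<phi> *v c)"
      by (simp add: inner_vec_def matrix_vector_mult_def mass_matrix_def sum_distrib_left ac_simps)
    also have "\<dots> = 0" by (simp add: c)
    finally have "(LINT x|lebesgue_on \<Omega>. (?u x)\<^sup>2) = 0" .
    moreover have "integrable (lebesgue_on \<Omega>) (\<lambda>x. (?u x)\<^sup>2)"
      unfolding sq by (intro Bochner_Integration.integrable_sum int)
    ultimately have "AE x in lebesgue_on \<Omega>. (?u x)\<^sup>2 = 0"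
      using integral_nonneg_eq_0_iff_AE[of "lebesgue_on \<Omega>" "\<lambda>x. (?u x)\<^sup>2"] by simp
    then have "ae_eq \<Omega> ?u (\<lambda>x. 0)"
      by (simp add: ae_eq_def)
    then have "\<forall>i. c $ i = 0"
      using indep unfolding L2_independent_def by blast
    then show ?thesis by (simp add: vec_eq_iff)
  qed
  then show ?thesis
    using matrix_left_invertible_ker invertible_left_inverse by blast
qed

lemma L2_inner_cong_ae:
  assumes "u \<in> L2 \<Omega>" "u' \<in> L2 \<Omega>" "v \<in> L2 \<Omega>" "v' \<in> L2 \<Omega>" "ae_eq \<Omega> u u'" "ae_eq \<Omega> v v'"
  shows "L2_inner \<Omega> u v = L2_inner \<Omega> u' v'"
  unfolding L2_inner_def
proof (rule integral_cong_AE)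
  show "AE x in lebesgue_on \<Omega>. u x * v x = u' x * v' x"
    using assms(5,6) unfolding ae_eq_def by eventually_elim simp
qed (use assms in \<open>auto simp: L2_def intro: borel_measurable_times\<close>)

text \<open>
  An operator whose inverse is symmetric is itself symmetric on its domain:
  \<open>(u, A v) = (S A u, A v) = (A u, S A v) = (A u, v)\<close>.
\<close>

lemma symmetric_of_self_adjoint_solution_operator:
  assumes A: "densely_defined_operator \<Omega> D A" and S: "self_adjoint_solution_operator \<Omega> D A S"
    and u: "u \<in> D" and v: "v \<in> D"
  shows "L2_inner \<Omega> u (A v) = L2_inner \<Omega> (A u) v"
proof -
  have L2: "u \<in> L2 \<Omega>" "v \<in> L2 \<Omega>" "A u \<in> L2 \<Omega>" "A v \<in> L2 \<Omega>"
    using A u v unfolding densely_defined_operator_def by blast+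
  have SA: "S (A u) \<in> L2 \<Omega>" "S (A v) \<in> L2 \<Omega>" "ae_eq \<Omega> (S (A u)) u" "ae_eq \<Omega> (S (A v)) v"
    using A S L2 u v
    unfolding densely_defined_operator_def self_adjoint_solution_operator_def by blast+
  have refl: "ae_eq \<Omega> f f" for f by (simp add: ae_eq_def)
  have "L2_inner \<Omega> u (A v) = L2_inner \<Omega> (S (A u)) (A v)"
    using L2 SA refl by (intro L2_inner_cong_ae[symmetric])
  also have "\<dots> = L2_inner \<Omega> (A u) (S (A v))"
    using S L2 unfolding self_adjoint_solution_operator_def by blast
  also have "\<dots> = L2_inner \<Omega> (A u) v"
    using L2 SA refl by (intro L2_inner_cong_ae)
  finally show ?thesis .
qed

lemma transpose_stiffness_matrix:
  assumes "densely_defined_operator \<Omega> D A" "self_adjoint_solution_operator \<Omega> D A S" "\<And>i. \<phi> i \<in> D"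
  shows "transpose (stiffness_matrix \<Omega> A \<phi>) = stiffness_matrix \<Omega> A \<phi>"
proof -
  have "L2_inner \<Omega> (\<phi> j) (A (\<phi> i)) = L2_inner \<Omega> (\<phi> i) (A (\<phi> j))" for i j
    by (subst symmetric_of_self_adjoint_solution_operator[OF assms(1,2) assms(3) assms(3)])
      (simp add: L2_inner_def mult.commute)
  then show ?thesis
    by (simp add: transpose_def stiffness_matrix_def)
qed


section \<open>The whitened posterior\<close>

lemma noise_inv_sqrt_square:
  assumes "\<And>k. \<sigma> $ k > 0"
  shows "noise_inv_sqrt \<sigma> ** noise_inv_sqrt \<sigma> = matrix_inv (noise_cov \<sigma>)"
proof -
  have "noise_cov \<sigma> ** (noise_inv_sqrt \<sigma> ** noise_inv_sqrt \<sigma>) = mat 1"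
    unfolding noise_cov_def noise_inv_sqrt_def Diag_mult_Diag
    using assms by (auto simp: Diag_def mat_def vec_eq_iff less_imp_le less_imp_neq[symmetric])
  then show ?thesis
    by (rule matrix_inv_unique_right(2)[symmetric])
qed

text \<open>
  The matrices \<open>B = C\<^sub>0\<^sup>1\<^sup>/\<^sup>2 M\<^sup>-\<^sup>1\<^sup>/\<^sup>2\<close> and \<open>B' = M\<^sup>1\<^sup>/\<^sup>2 C\<^sub>0\<^sup>1\<^sup>/\<^sup>2\<close> reduce the prior precision to the identity:
  \<open>B' C\<^sub>0\<^sup>-\<^sup>1 B = I\<close>. They also satisfy \<open>B\<^sup>T = B' M\<^sup>-\<^sup>1\<close>, that is, \<open>B'\<close> is the adjoint of \<open>B\<close> between \<open>\<real>\<^sup>n\<close> and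
  \<open>\<real>\<^sup>n\<^sub>M\<close>; this relies on the symmetry of the stiffness matrix. Consequently
  \<open>B'\<close> turns the adjoint of the noise-scaled forward map into the plain transpose of \<open>F\<close>.
\<close>

lemma post_precision_whitened:
  fixes M Mh K :: "real^'n^'n" and \<F> :: "real^'n^'m" and \<sigma> :: "real^'m"
  assumes M: "M = transpose Mh ** Mh" "invertible M" "invertible Mh"
    and K: "invertible K" "transpose K = K"
  defines "B \<equiv> prior_cov_sqrt M K ** matrix_inv Mh" and "B' \<equiv> Mh ** prior_cov_sqrt M K"
  defines "F \<equiv> noise_inv_sqrt \<sigma> ** \<F> ** B"
  shows "B' ** (adjoint_M M \<F> ** noise_inv_sqrt \<sigma>) = transpose F"
    and "B' ** post_precision M K \<F> \<sigma> w ** B = transpose F ** Diag w ** F + mat 1"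
proof -
  let ?G = "noise_inv_sqrt \<sigma>"
  have B: "B = matrix_inv K ** transpose Mh"
    unfolding B_def prior_cov_sqrt_def M(1)
    by (simp add: invertible_matrix_inv_right[OF M(3)] flip: matrix_mul_assoc)
  have BT: "transpose B = B' ** matrix_inv M"
    unfolding B B'_def prior_cov_sqrt_def
    by (simp add: matrix_transpose_mul transpose_matrix_inv K invertible_matrix_inv_right[OF M(2)]
        flip: matrix_mul_assoc)
  have GT: "transpose ?G = ?G"
    by (simp add: noise_inv_sqrt_def transpose_Diag)
  show adj: "B' ** (adjoint_M M \<F> ** ?G) = transpose F"
    by (simp add: F_def matrix_transpose_mul BT GT adjoint_M_def matrix_mul_assoc)
  have C0h: "invertible (prior_cov_sqrt M K)"
    unfolding prior_cov_sqrt_def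
    by (meson K(1) M(2) invertible_mult invertible_left_inverse invertible_matrix_inv_right
        invertible_right_inverse)
  then have C0: "prior_cov_sqrt M K ** matrix_inv (prior_cov M K) ** prior_cov_sqrt M K = mat 1"
  proof -
    let ?S = "prior_cov_sqrt M K"
    have "matrix_inv (prior_cov M K) = matrix_inv ?S ** matrix_inv ?S"
      unfolding prior_cov_def
      by (rule matrix_inv_unique_right)
        (metis C0h invertible_matrix_inv_right matrix_mul_assoc matrix_mul_rid)
    then show ?thesis
      by (metis C0h invertible_matrix_inv_right invertible_matrix_inv_left matrix_mul_assoc matrix_mul_rid)
  qed
  have "B' ** matrix_inv (prior_cov M K) ** B
      = Mh ** (prior_cov_sqrt M K ** matrix_inv (prior_cov M K) ** prior_cov_sqrt M K) ** matrix_inv Mh"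
    by (simp add: B'_def B_def matrix_mul_assoc)
  also have "\<dots> = mat 1"
    by (simp add: C0 invertible_matrix_inv_right[OF M(3)])
  finally have prior: "B' ** matrix_inv (prior_cov M K) ** B = mat 1" .
  have "B' ** (adjoint_M M \<F> ** ?G ** Diag w ** ?G ** \<F>) ** B
      = (B' ** (adjoint_M M \<F> ** ?G)) ** Diag w ** (?G ** \<F> ** B)"
    by (simp only: matrix_mul_assoc)
  then have "B' ** (adjoint_M M \<F> ** ?G ** Diag w ** ?G ** \<F>) ** B = transpose F ** Diag w ** F"
    by (simp only: adj F_def)
  then show "B' ** post_precision M K \<F> \<sigma> w ** B = transpose F ** Diag w ** F + mat 1"
    by (simp add: post_precision_def matrix_add_ldistrib matrix_add_rdistrib prior)
qed

text \<open>
  From \<open>C\<^sub>p\<^sub>o\<^sub>s\<^sub>t P = I\<close>, where \<open>P\<close> is the posterior precision, one has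
  \<open>C\<^sub>p\<^sub>o\<^sub>s\<^sub>t C\<^sub>0\<^sup>-\<^sup>1 = I - T Diag(w) G \<F>\<close>. The weights enter the precision linearly, whereas
  \<open>\<F>\<^sub>w\<^sup>* \<Gamma>\<^sup>-\<^sup>1 \<F>\<^sub>w\<close> in the mean is quadratic in them: there \<open>m\<^sub>0\<close> enters the data misfit as
  \<open>Diag(w)\<^sup>2 \<F> m\<^sub>0\<close>, but in the identity above as \<open>Diag(w) \<F> m\<^sub>0\<close>. The shift of the data by \<open>(I - Diag(w)) \<F> m\<^sub>0\<close>
  accounts for the difference.
\<close>

lemma post_mean_gain:
  fixes M K :: "real^'n^'n" and \<F> :: "real^'n^'m" and \<sigma> :: "real^'m"
  assumes \<sigma>: "\<And>k. \<sigma> $ k > 0" and P: "invertible (post_precision M K \<F> \<sigma> w)"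
  defines "G \<equiv> noise_inv_sqrt \<sigma>"
  defines "T \<equiv> post_cov M K \<F> \<sigma> w ** (adjoint_M M \<F> ** G)"
  shows "post_mean M K \<F> \<sigma> g m0 w =
    (T ** G) *v (Diag w *v (g + (mat 1 - Diag w) *v (\<F> *v m0)))
      + (post_cov M K \<F> \<sigma> w ** matrix_inv (prior_cov M K)) *v m0"
proof -
  have comm: "Diag w ** G = G ** Diag w"
    unfolding G_def noise_inv_sqrt_def by (rule Diag_commute)
  have "adjoint_M M (design_map \<F> w) ** matrix_inv (noise_cov \<sigma>)
      = adjoint_M M \<F> ** (Diag w ** G) ** G"
    by (simp add: adjoint_M_def design_map_def matrix_transpose_mul transpose_Diag G_def
        matrix_mul_assoc flip: noise_inv_sqrt_square[OF \<sigma>])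
  also have "\<dots> = adjoint_M M \<F> ** G ** (Diag w ** G)"
    by (subst comm) (simp only: matrix_mul_assoc)
  also have "\<dots> = adjoint_M M \<F> ** G ** G ** Diag w"
    unfolding comm by (simp only: matrix_mul_assoc)
  finally have "post_cov M K \<F> \<sigma> w ** adjoint_M M (design_map \<F> w) ** matrix_inv (noise_cov \<sigma>)
      = T ** G ** Diag w"
    unfolding T_def by (metis matrix_mul_assoc)
  then have mean: "post_mean M K \<F> \<sigma> g m0 w = m0 + (T ** G ** Diag w) *v (g - (Diag w ** \<F>) *v m0)"
    by (simp add: post_mean_def design_map_def)
  have "post_cov M K \<F> \<sigma> w ** (adjoint_M M \<F> ** G ** Diag w ** G ** \<F>)
      + post_cov M K \<F> \<sigma> w ** matrix_inv (prior_cov M K) = mat 1"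
    using invertible_matrix_inv_left[OF P]
    by (simp add: post_precision_def post_cov_def matrix_add_ldistrib G_def)
  moreover have "post_cov M K \<F> \<sigma> w ** (adjoint_M M \<F> ** G ** Diag w ** G ** \<F>)
      = T ** (Diag w ** G) ** \<F>"
    by (simp only: T_def matrix_mul_assoc)
  moreover have "\<dots> = T ** G ** Diag w ** \<F>"
    by (simp only: comm matrix_mul_assoc)
  ultimately have prior: "post_cov M K \<F> \<sigma> w ** matrix_inv (prior_cov M K)
      = mat 1 - T ** G ** Diag w ** \<F>"
    by (simp add: algebra_simps)
  show ?thesis
    unfolding mean prior
    by (simp add: matrix_vector_mult_diff_rdistrib matrix_vector_mult_diff_distrib
        matrix_vector_right_distrib flip: matrix_vector_mul_assoc)
qed


section \<open>The posterior and the A-optimal objective in reduced form\<close>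

theorem theorem8:
  fixes \<Omega> :: "(real^'d) set"
    and dom :: "(real^'d \<Rightarrow> real) set"
    and \<KK> S :: "(real^'d \<Rightarrow> real) \<Rightarrow> (real^'d \<Rightarrow> real)"
    and \<phi> :: "'n::finite \<Rightarrow> real^'d \<Rightarrow> real"
    and M Mh Mih K C0 C0h :: "real^'n^'n"
    and \<F> F :: "real^'n^('m::{finite,linorder})"
    and \<sigma> :: "real^('m::{finite,linorder})"
    and \<Gamma>ih :: "real^('m::{finite,linorder})^('m::{finite,linorder})"
    and Q :: "real^('l::{finite,linorder})^'n"
    and R :: "real^('m::{finite,linorder})^('l::{finite,linorder})"
    and L :: "real^('m::{finite,linorder}) \<Rightarrow> real^('l::{finite,linorder})^('l::{finite,linorder})"
    and C Ch :: "real^('l::{finite,linorder})^('l::{finite,linorder})"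
    and Cpost :: "real^('m::{finite,linorder}) \<Rightarrow> real^'n^'n"
    and mpost :: "real^'n \<Rightarrow> real^('m::{finite,linorder}) \<Rightarrow> real^('m::{finite,linorder}) \<Rightarrow> real^'n"
    and J :: "real^('m::{finite,linorder}) \<Rightarrow> real"
  assumes "compact \<Omega>"
    and "densely_defined_operator \<Omega> dom \<KK>"
    and "self_adjoint_solution_operator \<Omega> dom \<KK> S"
    and "\<And>i. \<phi> i \<in> L2 \<Omega> \<inter> dom"
    and "L2_independent \<Omega> \<phi>"
    and "Lagrange_basis \<Omega> \<phi>"
    and "M = mass_matrix \<Omega> \<phi>"
    and "K = stiffness_matrix \<Omega> \<KK> \<phi>"
    and "invertible K"
    and "M = transpose Mh ** Mh"
    and "Mih = matrix_inv Mh"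
    and "C0h = prior_cov_sqrt M K"
    and "C0 = prior_cov M K"
    and "\<And>k. \<sigma> $ k > 0"
    and "\<Gamma>ih = noise_inv_sqrt \<sigma>"
    and "Cpost = post_cov M K \<F> \<sigma>"
    and "mpost = (\<lambda>m0 g. post_mean M K \<F> \<sigma> g m0)"
    and "J = A_objective M K \<F> \<sigma>"
    and "F = \<Gamma>ih ** \<F> ** C0h ** Mih"
    and "transpose F = Q ** R"
    and "transpose Q ** Q = mat 1"
    and "upper_triangular R"
    and "L = (\<lambda>w. R ** Diag w ** transpose R + mat 1)"
    and "C = transpose Q ** Mh ** C0 ** Mih ** Q"
    and "C = transpose Ch ** Ch"
  shows "\<exists>U. open U \<and> {w. \<forall>k. 0 \<le> w $ k \<and> w $ k \<le> 1} \<subseteq> U \<and>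
    (\<forall>w\<in>U.
       invertible (post_precision M K \<F> \<sigma> w) \<and> invertible (L w) \<and>
       (\<forall>g m0.
          let mean = (\<lambda>g'. (C0h ** Mih ** Q ** matrix_inv (L w) ** R ** \<Gamma>ih) *v g'
                          + (Cpost w ** matrix_inv C0) *v m0)
          in ((\<forall>k. w $ k \<in> {0, 1}) \<and> Diag w *v g = g \<longrightarrow> mpost m0 g w = mean g) \<and>
             ((\<forall>k. w $ k \<in> {0, 1}) \<longrightarrow> mpost m0 g w = mean (Diag w *v g)) \<and>
             mpost m0 g w = mean (Diag w *v (g + (mat 1 - Diag w) *v (\<F> *v m0)))) \<and>
       Cpost w = C0h ** Mih ** (mat 1 - Q ** transpose Q + Q ** matrix_inv (L w) ** transpose Q)
                   ** Mh ** C0h \<and>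
       J w = trace (matrix_inv (transpose F ** Diag w ** F + mat 1) ** Mh ** C0 ** Mih) \<and>
       J w = trace C0 - trace C + trace (matrix_inv (L w) ** C) \<and>
       GDERIV J w :> (\<chi> k. - (norm (Ch *v (matrix_inv (L w) *v (R *v axis k 1))))\<^sup>2) \<and>
       has_Hessian J
         (2 *\<^sub>R ((transpose R ** matrix_inv (L w) ** C ** matrix_inv (L w) ** R)
                \<odot> (transpose R ** matrix_inv (L w) ** R))) w)"
proof -
  note asm = assms
  have L2: "\<phi> i \<in> L2 \<Omega>" and dom: "\<phi> i \<in> dom" for i using asm(4) by auto
  have M: "invertible M"
    unfolding asm(7) by (rule invertible_mass_matrix[OF L2 asm(5)])
  have Mh: "invertible Mh"
  proof -
    have "(matrix_inv M ** transpose Mh) ** Mh = mat 1"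
      using invertible_matrix_inv_left[OF M] asm(10) by (simp add: matrix_mul_assoc[symmetric])
    then show ?thesis using invertible_left_inverse by blast
  qed
  have K: "transpose K = K"
    unfolding asm(8) by (rule transpose_stiffness_matrix[OF asm(2,3) dom])
  have L: "L = reduced_precision R"
    by (simp add: asm(23) reduced_precision_def[abs_def])
  define B where "B = C0h ** Mih"
  define B' where "B' = Mh ** C0h"
  have FB: "F = \<Gamma>ih ** \<F> ** B"
    by (simp only: asm(19) B_def matrix_mul_assoc)
  have F: "F = transpose R ** transpose Q"
    by (metis asm(20) matrix_transpose_mul transpose_transpose)
  note white = post_precision_whitened[OF asm(10) M Mh asm(9) K, where \<sigma> = \<sigma> and \<F> = \<F>,
      folded asm(11,12,15), folded B_def B'_def, folded FB]
  have B'B: "trace (A ** (B' ** B)) = trace (A ** Mh ** C0 ** Mih)" for A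
    by (simp add: B_def B'_def asm(12,13) prior_cov_def matrix_mul_assoc)
  have C_sym: "transpose C = C"
    unfolding asm(25) by (simp add: matrix_transpose_mul)
  \<comment> \<open>The formulas need only \<open>L\<^sub>w\<close> to be invertible, which makes this the largest possible neighbourhood.\<close>
  define U where "U = {w. invertible (L w)}"
  have "open U"
    unfolding U_def L by (intro open_invertible_preimage continuous_on_reduced_precision)
  moreover have "{w. \<forall>k. 0 \<le> w $ k \<and> w $ k \<le> 1} \<subseteq> U"
    unfolding U_def L by (auto intro: invertible_reduced_precision)
  moreover have main: "invertible (post_precision M K \<F> \<sigma> w)"
      "Cpost w = B ** (mat 1 - Q ** transpose Q + Q ** matrix_inv (L w) ** transpose Q) ** B'"
      "Cpost w ** (adjoint_M M \<F> ** \<Gamma>ih) = B ** Q ** matrix_inv (L w) ** R"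
      "J w = trace (matrix_inv (transpose F ** Diag w ** F + mat 1) ** Mh ** C0 ** Mih)"
      "J w = trace C0 - trace C + trace (matrix_inv (L w) ** C)" if "w \<in> U" for w
  proof -
    let ?X = "transpose F ** Diag w ** F + mat 1" and ?A = "R ** Diag w ** transpose R"
    let ?N = "matrix_inv (L w)"
    have inv: "invertible (?A + mat 1)" using that by (simp add: U_def asm(23))
    have X: "?X = Q ** ?A ** transpose Q + mat 1"
      by (simp only: F matrix_transpose_mul transpose_transpose matrix_mul_assoc)
    note woodbury = matrix_inv_low_rank_plus_identity[OF asm(21) inv, folded X]
    have LA: "L w = ?A + mat 1" by (simp add: asm(23))
    note post = matrix_inv_factorised[OF white(2) woodbury(1)]
    show "invertible (post_precision M K \<F> \<sigma> w)" by (rule post(1))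
    have Cpost: "Cpost w = B ** matrix_inv ?X ** B'"
      unfolding asm(16) post_cov_def by (rule post(2))
    show "Cpost w = B ** (mat 1 - Q ** transpose Q + Q ** ?N ** transpose Q) ** B'"
      unfolding Cpost woodbury(2) LA ..
    have "Cpost w ** (adjoint_M M \<F> ** \<Gamma>ih) = B ** matrix_inv ?X ** (B' ** (adjoint_M M \<F> ** \<Gamma>ih))"
      unfolding Cpost by (simp only: matrix_mul_assoc)
    also have "\<dots> = B ** (matrix_inv ?X ** Q) ** R"
      unfolding white(1) asm(20) by (simp only: matrix_mul_assoc)
    finally show "Cpost w ** (adjoint_M M \<F> ** \<Gamma>ih) = B ** Q ** ?N ** R"
      unfolding woodbury(3) LA by (simp only: matrix_mul_assoc)
    have "J w = trace (B ** (matrix_inv ?X ** B'))"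
      by (simp only: asm(18) A_objective_def asm(16)[symmetric] Cpost matrix_mul_assoc)
    also have "\<dots> = trace (matrix_inv ?X ** (B' ** B))"
      unfolding trace_mul_sym[of B] by (simp only: matrix_mul_assoc)
    finally have J: "J w = trace (matrix_inv ?X ** (B' ** B))" .
    then show "J w = trace (matrix_inv ?X ** Mh ** C0 ** Mih)" by (simp only: B'B)
    have tC0: "trace (B' ** B) = trace C0"
    proof -
      have "trace (B' ** B) = trace (Mh ** (C0 ** Mih))"
        using B'B[of "mat 1"] by (simp add: matrix_mul_assoc)
      also have "\<dots> = trace C0"
        unfolding trace_mul_sym[of Mh]
        by (simp add: asm(11) invertible_matrix_inv_left[OF Mh] flip: matrix_mul_assoc)
      finally show ?thesis .
    qed
    have CB: "C = transpose Q ** (B' ** B) ** Q"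
      by (simp add: asm(12,13,24) B_def B'_def prior_cov_def matrix_mul_assoc)
    have "trace (Q ** (transpose Q ** (B' ** B))) = trace C"
      unfolding trace_mul_sym[of Q] CB by (simp only: matrix_mul_assoc)
    moreover have "trace (Q ** (?N ** transpose Q ** (B' ** B))) = trace (?N ** C)"
      unfolding trace_mul_sym[of Q] CB by (simp only: matrix_mul_assoc)
    ultimately show "J w = trace C0 - trace C + trace (?N ** C)"
      unfolding J woodbury(2) LA[symmetric]
      by (simp add: matrix_add_rdistrib matrix_diff_left trace_add trace_sub tC0 matrix_mul_assoc)
  qed
  have grad: "GDERIV J w :> (\<chi> k. - (transpose R ** matrix_inv (L w) ** C ** matrix_inv (L w) ** R) $ k $ k)"
    if w: "w \<in> U" for w
  proof -
    have "GDERIV (\<lambda>v. trace C0 - trace C + trace (matrix_inv (L v) ** C)) w :>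
        0 + (\<chi> k. - (transpose R ** matrix_inv (L w) ** C ** matrix_inv (L w) ** R) $ k $ k)"
      unfolding L by (intro GDERIV_add GDERIV_const GDERIV_trace_inv_reduced_precision)
        (use w in \<open>simp add: U_def L\<close>)
    then show ?thesis
      unfolding gderiv_def add_0_left
      by (rule has_derivative_transform_within_open[OF _ \<open>open U\<close> w]) (simp add: main(5))
  qed
  have grad_norm: "(transpose R ** matrix_inv (L w) ** C ** matrix_inv (L w) ** R) $ k $ k
      = (norm (Ch *v (matrix_inv (L w) *v (R *v axis k 1))))\<^sup>2" if w: "w \<in> U" for w k
  proof -
    have "transpose (matrix_inv (L w)) = matrix_inv (L w)"
      using w by (simp add: L U_def transpose_matrix_inv transpose_reduced_precision)
    then have "transpose R ** matrix_inv (L w) ** C ** matrix_inv (L w) ** R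
        = transpose (Ch ** matrix_inv (L w) ** R) ** (Ch ** matrix_inv (L w) ** R)"
      by (simp only: asm(25) matrix_transpose_mul matrix_mul_assoc)
    then have "(transpose R ** matrix_inv (L w) ** C ** matrix_inv (L w) ** R) $ k $ k
        = (norm ((Ch ** matrix_inv (L w) ** R) *v axis k 1))\<^sup>2"
      by (simp only: Gram_diagonal)
    then show ?thesis
      by (simp only: matrix_vector_mul_assoc matrix_mul_assoc)
  qed
  have hess: "has_Hessian J
      (2 *\<^sub>R ((transpose R ** matrix_inv (L w) ** C ** matrix_inv (L w) ** R)
        \<odot> (transpose R ** matrix_inv (L w) ** R))) w" if w: "w \<in> U" for w
    unfolding has_Hessian_def
  proof (intro exI conjI)
    show "\<forall>\<^sub>F v in nhds w. GDERIV J v :>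
        (\<chi> k. - (transpose R ** matrix_inv (L v) ** C ** matrix_inv (L v) ** R) $ k $ k)"
      using eventually_nhds_in_open[OF \<open>open U\<close> w] by eventually_elim (rule grad)
    show "((\<lambda>v. \<chi> k. - (transpose R ** matrix_inv (L v) ** C ** matrix_inv (L v) ** R) $ k $ k)
        has_derivative (*v) (2 *\<^sub>R ((transpose R ** matrix_inv (L w) ** C ** matrix_inv (L w) ** R)
          \<odot> (transpose R ** matrix_inv (L w) ** R)))) (at w)"
      unfolding L using w
      by (intro has_derivative_gradient_trace_inv_reduced_precision C_sym) (simp add: U_def L)
  qed
  have mean: "mpost m0 g w = (B ** Q ** matrix_inv (L w) ** R ** \<Gamma>ih) *v
        (Diag w *v (g + (mat 1 - Diag w) *v (\<F> *v m0))) + (Cpost w ** matrix_inv C0) *v m0"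
    if w: "w \<in> U" for w g m0
    using post_mean_gain[OF asm(14) main(1)[OF w], of g m0, folded asm(13,15,16), unfolded main(3)[OF w]]
    by (simp only: asm(17))
  \<comment> \<open>For a binary design \<open>Diag w\<close> is a projection, so the shift of the data is annihilated.\<close>
  have binary: "Diag w *v (g + (mat 1 - Diag w) *v y) = Diag w *v g"
    if "\<forall>k. w $ k \<in> {0, 1}" for w g y
    using Diag_idempotent[OF that]
    by (simp add: matrix_vector_right_distrib matrix_vector_mult_diff_rdistrib
        matrix_vector_mult_diff_distrib matrix_vector_mul_assoc)
  show ?thesis
  proof (rule exI[of _ U], intro conjI ballI)
    fix w assume w: "w \<in> U"
    show "\<forall>g m0.
          let mean = (\<lambda>g'. (C0h ** Mih ** Q ** matrix_inv (L w) ** R ** \<Gamma>ih) *v g'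
                          + (Cpost w ** matrix_inv C0) *v m0)
          in ((\<forall>k. w $ k \<in> {0, 1}) \<and> Diag w *v g = g \<longrightarrow> mpost m0 g w = mean g) \<and>
             ((\<forall>k. w $ k \<in> {0, 1}) \<longrightarrow> mpost m0 g w = mean (Diag w *v g)) \<and>
             mpost m0 g w = mean (Diag w *v (g + (mat 1 - Diag w) *v (\<F> *v m0)))"
      unfolding Let_def mean[OF w] B_def
    proof (intro allI conjI impI)
      fix g m0 assume "(\<forall>k. w $ k \<in> {0, 1}) \<and> Diag w *v g = g"
      then have "Diag w *v (g + (mat 1 - Diag w) *v (\<F> *v m0)) = g"
        using binary by metis
      then show "(C0h ** Mih ** Q ** matrix_inv (L w) ** R ** \<Gamma>ih) *v
            (Diag w *v (g + (mat 1 - Diag w) *v (\<F> *v m0))) + (Cpost w ** matrix_inv C0) *v m0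
          = (C0h ** Mih ** Q ** matrix_inv (L w) ** R ** \<Gamma>ih) *v g + (Cpost w ** matrix_inv C0) *v m0"
        by (rule arg_cong)
    next
      fix g m0 assume "\<forall>k. w $ k \<in> {0, 1}"
      then show "(C0h ** Mih ** Q ** matrix_inv (L w) ** R ** \<Gamma>ih) *v
            (Diag w *v (g + (mat 1 - Diag w) *v (\<F> *v m0))) + (Cpost w ** matrix_inv C0) *v m0
          = (C0h ** Mih ** Q ** matrix_inv (L w) ** R ** \<Gamma>ih) *v (Diag w *v g)
            + (Cpost w ** matrix_inv C0) *v m0"
        by (subst binary) (assumption, rule refl)
    qed (rule refl)
    show "Cpost w = C0h ** Mih ** (mat 1 - Q ** transpose Q + Q ** matrix_inv (L w) ** transpose Q)
                   ** Mh ** C0h"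
      by (simp only: main(2)[OF w] B_def B'_def matrix_mul_assoc)
    show "GDERIV J w :> (\<chi> k. - (norm (Ch *v (matrix_inv (L w) *v (R *v axis k 1))))\<^sup>2)"
      using grad[OF w] by (simp only: grad_norm[OF w])
    show "invertible (L w)" using w by (simp add: U_def)
  qed (fact | rule main(1) main(4) main(5) hess, assumption)+
qed

end
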